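(* Let $v$ be a non-zero vector in $\mathbb{R}^d$ and let $K \subset \mathbb{R}^d$ be compact. Suppose that for any $2d$ points in $K$ there is a line segment with $v$-width at least $1$ such that every point on the segment sees all $2d$ points. Then there is a line segment with $v$-width at least $1$ such that every point on the segment sees all of $K$.
   Context: For $K \subset \mathbb{R}^d$ and $x,y \in K$, $x$ sees $y$ if the closed segment $[x,y]$ is contained in $K$. For a non-zero vector $v$ and a compact set $M \subset \mathbb{R}^d$, the $v$-width of $M$ is $\max_{x,y \in M} \langle x-y, v\rangle$. *)

theory Defs
  imports "HOL-Analysis.Analysis"
begin

(* The memberships "x \<in> K" and "y \<in> K" need not be stated: they are the
   endpoint cases of the inclusion. *)
definition sees :: "('a::real_vector) set \<Rightarrow> 'a \<Rightarrow> 'a \<Rightarrow> bool" where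
  "sees K x y \<longleftrightarrow> closed_segment x y \<subseteq> K"

(* The supremum is attained, hence a maximum, for compact nonempty M.
   For other M the value is not meaningful. *)
definition v_width :: "('a::real_inner) \<Rightarrow> 'a set \<Rightarrow> real" where
  "v_width v M = (SUP (x, y)\<in>M \<times> M. (x - y) \<bullet> v)"

end

theory Submission imports Defs begin

text \<open>A segment \<open>[a, b]\<close> of \<open>v\<close>-width at least \<open>1\<close> can be shortened to have
  \<open>\<langle>a - b, v\<rangle> = 1\<close>, so it is a point \<open>(a, b)\<close> of a hyperplane of dimension \<open>2d - 1\<close> in
  \<open>\<real>\<^sup>d \<times> \<real>\<^sup>d\<close>. Writing \<open>V\<^sub>x\<close> for the set of points that see \<open>x\<close>, Helly's theorem with Helly
  number \<open>2d\<close> in this hyperplane, applied to the sets \<open>conv V\<^sub>x \<times> conv V\<^sub>x\<close>, gives a segment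
  of width \<open>1\<close> inside all \<open>conv V\<^sub>x\<close>. By Krasnosel'skii's nearest point argument every point in
  the intersection of all \<open>conv V\<^sub>x\<close> sees all of \<open>K\<close>.\<close>

text \<open>Helly's theorem by Radon partitions. Measuring dimension by a common superset
  \<open>H\<close> of the sets, not by the ambient space, saves one set in a hyperplane: the Helly
  number there is 2d and not 2d + 1.\<close>

lemma Helly_aff_dim:
  fixes S :: "'i \<Rightarrow> 'a::euclidean_space set"
  assumes "finite I" and "k > 0" and "aff_dim H < int k"
    and "\<And>i. i \<in> I \<Longrightarrow> convex (S i)"
    and "\<And>i. i \<in> I \<Longrightarrow> S i \<subseteq> H"
    and "\<And>J. J \<subseteq> I \<Longrightarrow> card J \<le> k \<Longrightarrow> (\<Inter>i\<in>J. S i) \<noteq> {}"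
  shows "(\<Inter>i\<in>I. S i) \<noteq> {}"
  using assms(1,4-6)
proof (induction rule: finite_psubset_induct)
  case (psubset I)
  show ?case
  proof (cases "card I \<le> k")
    case True
    then show ?thesis using psubset.prems(3) by blast
  next
    case False
    have "\<exists>z. z \<in> (\<Inter>j\<in>I - {i}. S j)" if "i \<in> I" for i
    proof -
      have "(\<Inter>j\<in>I - {i}. S j) \<noteq> {}"
      proof (rule psubset.IH)
        show "I - {i} \<subset> I" using that by blast
        show "(\<Inter>j\<in>J. S j) \<noteq> {}" if "J \<subseteq> I - {i}" "card J \<le> k" for J
          using psubset.prems(3)[of J] that by blast
      qed (use psubset.prems in auto)
      then show ?thesis by blast
    qed
    then obtain X where X: "\<And>i. i \<in> I \<Longrightarrow> X i \<in> (\<Inter>j\<in>I - {i}. S j)"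
      by metis
    then have XS: "X i \<in> S j" if "i \<in> I" "j \<in> I" "i \<noteq> j" for i j
      using that by blast
    show ?thesis
    proof (cases "inj_on X I")
      case inj: True
      have "X i \<in> H" if "i \<in> I" for i
      proof -
        \<comment> \<open>As \<open>card I > k \<ge> 1\<close>, there is a second index
          \<open>j\<close>, and \<open>X i\<close> lies in \<open>S j\<close>, hence in
          \<open>H\<close>.\<close>
        have "I \<noteq> {i}" using False \<open>k > 0\<close> by auto
        then obtain j where "j \<in> I" "i \<noteq> j" using \<open>i \<in> I\<close> by blast
        then show ?thesis using XS \<open>i \<in> I\<close> psubset.prems(2) by blast
      qed
      then have "aff_dim (X ` I) \<le> aff_dim H"
        by (intro aff_dim_subset) auto
      moreover have "card (X ` I) > k"
        using False card_image[OF inj] by simp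
      \<comment> \<open>An affinely independent subset of \<open>H\<close> has at most
        \<open>aff_dim H + 1 \<le> k\<close> points.\<close>
      ultimately have "affine_dependent (X ` I)"
        using aff_dim_affine_independent[of "X ` I"] \<open>aff_dim H < int k\<close> by fastforce
      then obtain M P where MP: "M \<subseteq> X ` I" "P \<subseteq> X ` I" "M \<inter> P = {}"
        and "convex hull M \<inter> convex hull P \<noteq> {}"
        by (rule Radon)
      then obtain z where z: "z \<in> convex hull M" "z \<in> convex hull P" by blast
      have "z \<in> S i" if i: "i \<in> I" for i
      proof -
        \<comment> \<open>Only \<open>X i\<close> itself may fail to lie in \<open>S i\<close>. As
          \<open>M\<close> and \<open>P\<close> are disjoint, at least one of them avoids
          it.\<close>
        have "N \<subseteq> S i" if "N \<subseteq> X ` I" "X i \<notin> N" for N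
          using that XS i by blast
        then have "M \<subseteq> S i \<or> P \<subseteq> S i" using MP by blast
        then show ?thesis
          using z psubset.prems(1)[OF i] by (meson hull_minimal subset_iff)
      qed
      then show ?thesis by blast
    next
      case False
      then obtain i j where ij: "i \<in> I" "j \<in> I" "i \<noteq> j" "X i = X j"
        by (auto simp: inj_on_def)
      \<comment> \<open>The common point lies in every \<open>S l\<close> with
        \<open>l \<noteq> i\<close> as \<open>X i\<close>, and in \<open>S i\<close> as
        \<open>X j\<close>.\<close>
      have "X i \<in> S l" if "l \<in> I" for l
        using XS ij that by metis
      then show ?thesis by blast
    qed
  qed
qed

lemma Helly_aff_dim_compact:
  fixes S :: "'i \<Rightarrow> 'a::euclidean_space set"
  assumes "k > 0" and "aff_dim H < int k"
    and "\<And>i. i \<in> I \<Longrightarrow> convex (S i)"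
    and "\<And>i. i \<in> I \<Longrightarrow> compact (S i)"
    and "\<And>i. i \<in> I \<Longrightarrow> S i \<subseteq> H"
    and "\<And>J. J \<subseteq> I \<Longrightarrow> finite J \<Longrightarrow> card J \<le> k \<Longrightarrow> (\<Inter>i\<in>J. S i) \<noteq> {}"
  shows "(\<Inter>i\<in>I. S i) \<noteq> {}"
proof -
  have "\<Inter>(S ` I) \<noteq> {}"
  proof (rule compact_fip_Heine_Borel)
    fix F assume "finite F" "F \<subseteq> S ` I"
    then obtain J where J: "J \<subseteq> I" "finite J" "F = S ` J"
      by (meson finite_subset_image)
    have "(\<Inter>i\<in>J. S i) \<noteq> {}"
    proof (rule Helly_aff_dim[OF J(2) assms(1,2)])
      fix L assume "L \<subseteq> J" "card L \<le> k"
      then show "(\<Inter>i\<in>L. S i) \<noteq> {}"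
        using assms(6)[of L] J finite_subset by blast
    qed (use J assms in blast)+
    then show "\<Inter>F \<noteq> {}" using J by simp
  qed (use assms in auto)
  then show ?thesis by simp
qed

text \<open>Two points of the segment differ by a multiple of \<open>a - b\<close> with factor in
  [-1, 1]; the two ends, in a suitable order, attain the maximum.\<close>

lemma v_width_closed_segment: "v_width v (closed_segment a b) = \<bar>(a - b) \<bullet> v\<bar>"
  unfolding v_width_def
proof (rule cSup_eq_maximum)
  have "(a, b) \<in> closed_segment a b \<times> closed_segment a b"
    "(b, a) \<in> closed_segment a b \<times> closed_segment a b" by auto
  then show "\<bar>(a - b) \<bullet> v\<bar> \<in> (\<lambda>(x, y). (x - y) \<bullet> v) ` (closed_segment a b \<times> closed_segment a b)"
    by (cases "(a - b) \<bullet> v \<ge> 0") (force simp: image_iff inner_diff_left)+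
next
  fix r assume "r \<in> (\<lambda>(x, y). (x - y) \<bullet> v) ` (closed_segment a b \<times> closed_segment a b)"
  then obtain s t where st: "0 \<le> s" "s \<le> 1" "0 \<le> t" "t \<le> 1"
    and "r = (((1 - s) *\<^sub>R a + s *\<^sub>R b) - ((1 - t) *\<^sub>R a + t *\<^sub>R b)) \<bullet> v"
    by (auto simp: closed_segment_def)
  then have "r = (t - s) * ((a - b) \<bullet> v)"
    by (simp add: inner_diff_left inner_add_left algebra_simps)
  then have "r \<le> \<bar>t - s\<bar> * \<bar>(a - b) \<bullet> v\<bar>"
    by (metis abs_ge_self abs_mult)
  also have "\<dots> \<le> \<bar>(a - b) \<bullet> v\<bar>"
    using st by (intro mult_left_le_one_le) auto
  finally show "r \<le> \<bar>(a - b) \<bullet> v\<bar>" .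
qed

lemma segment_unit_width:
  assumes "1 \<le> v_width v (closed_segment a b)"
  obtains c d where "c \<in> closed_segment a b" "d \<in> closed_segment a b" "(c - d) \<bullet> v = 1"
proof -
  define w where "w = (a - b) \<bullet> v"
  have w: "\<bar>w\<bar> \<ge> 1"
    using assms by (simp add: v_width_closed_segment w_def)
  \<comment> \<open>The fraction \<open>1 / \<bar>w\<bar>\<close> of the segment, measured from
    \<open>a\<close>, has width exactly 1. The sign of \<open>w\<close> decides which end comes
    first.\<close>
  let ?d = "(1 - 1 / \<bar>w\<bar>) *\<^sub>R a + (1 / \<bar>w\<bar>) *\<^sub>R b"
  have d: "?d \<in> closed_segment a b"
    unfolding closed_segment_def using w by (intro CollectI exI[of _ "1 / \<bar>w\<bar>"]) auto
  have "a - ?d = (1 / \<bar>w\<bar>) *\<^sub>R (a - b)"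
    by (simp add: algebra_simps)
  then have ad: "(a - ?d) \<bullet> v = w / \<bar>w\<bar>" by (simp add: w_def)
  show ?thesis
  proof (cases "w > 0")
    case True
    then show ?thesis using that[of a ?d] d ad by simp
  next
    case False
    then have "(a - ?d) \<bullet> v = -1" using ad w by simp
    then have "(?d - a) \<bullet> v = 1" by (simp add: inner_diff_left)
    then show ?thesis using that[of ?d a] d by simp
  qed
qed

lemma compact_seeing_set:
  fixes K :: "'a::euclidean_space set"
  assumes "compact K"
  shows "compact {p. sees K p x}"
proof -
  \<comment> \<open>For each fixed parameter \<open>t\<close> the condition on \<open>p\<close> is a
    preimage of \<open>K\<close> under a continuous map.\<close>
  have "{p. sees K p x} = (\<Inter>t\<in>{0..1}. (\<lambda>p. (1 - t) *\<^sub>R p + t *\<^sub>R x) -` K)"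
    by (auto simp: sees_def closed_segment_image_interval)
  moreover have "closed \<dots>"
    using assms
    by (intro closed_INT ballI closed_vimage compact_imp_closed continuous_intros)
  moreover have "{p. sees K p x} \<subseteq> K"
    by (auto simp: sees_def)
  ultimately show ?thesis
    using assms by (metis compact_Int_closed inf.absorb2)
qed

text \<open>If \<open>y\<close> does not see \<open>x\<close>, some segment \<open>[u, w]\<close> on
  \<open>[y, x]\<close> avoids \<open>K\<close>, and its point \<open>p\<close> nearest to
  \<open>K\<close> is not the end \<open>u\<close> facing \<open>y\<close>. With \<open>x0\<close>
  nearest to \<open>p\<close> in \<open>K\<close>, the hyperplane through \<open>x0\<close>
  orthogonal to \<open>p - x0\<close> then cuts \<open>y\<close> off from all points that see
  \<open>x0\<close>.\<close>

lemma seeing_all_if_in_hulls: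
  fixes K :: "'a::euclidean_space set"
  assumes "compact K" and hull: "\<And>x. x \<in> K \<Longrightarrow> y \<in> convex hull {p. sees K p x}"
    and "x \<in> K"
  shows "sees K y x"
proof (rule ccontr)
  assume "\<not> sees K y x"
  then obtain u where u: "u \<in> closed_segment y x" "u \<notin> K"
    by (auto simp: sees_def)
  then obtain s where s: "0 \<le> s" "s \<le> 1" "u = (1 - s) *\<^sub>R y + s *\<^sub>R x"
    by (auto simp: closed_segment_def)
  have "closed K" using \<open>compact K\<close> by (rule compact_imp_closed)
  have "u \<noteq> x" using u \<open>x \<in> K\<close> by blast
  obtain e where e: "e > 0" "\<And>z. z \<in> K \<Longrightarrow> e \<le> dist u z"
    using separate_point_closed[OF \<open>closed K\<close> u(2)] by blast
  obtain x' where x': "x' \<in> K \<inter> closed_segment u x"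
    and x'_min: "\<And>z. z \<in> K \<inter> closed_segment u x \<Longrightarrow> dist u x' \<le> dist u z"
  proof -
    have "closed (K \<inter> closed_segment u x)" "K \<inter> closed_segment u x \<noteq> {}"
      using \<open>closed K\<close> \<open>x \<in> K\<close> by auto
    from distance_attains_inf[OF this, of u] show ?thesis using that by blast
  qed
  define D where "D = dist u x'"
  have D: "D \<ge> e" using e x' by (simp add: D_def)
  \<comment> \<open>This puts \<open>w\<close> at distance \<open>e / 2\<close> from
    \<open>x'\<close>: closer to \<open>K\<close> than \<open>u\<close> is, but short of the first
    point of \<open>K\<close> on the way from \<open>u\<close> to \<open>x\<close>.\<close>
  define q where "q = e / (2 * D)"
  have q: "q > 0" "q < 1" using D e by (auto simp: q_def field_simps)
  define w where "w = q *\<^sub>R u + (1 - q) *\<^sub>R x'"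
  have "dist w x' = q * D"
  proof -
    have "w - x' = q *\<^sub>R (u - x')" by (simp add: w_def algebra_simps)
    then show ?thesis using q by (simp add: dist_norm D_def)
  qed
  then have wx': "dist w x' < e" using D e by (simp add: q_def)
  have "dist u w = (1 - q) * D"
  proof -
    have "u - w = (1 - q) *\<^sub>R (u - x')" by (simp add: w_def algebra_simps)
    then show ?thesis using q by (simp add: dist_norm D_def)
  qed
  then have uw: "dist u w < D" using D e q by simp
  have "w \<in> closed_segment u x'"
    unfolding closed_segment_def w_def using q by (intro CollectI exI[of _ "1 - q"]) auto
  then have "w \<in> closed_segment u x"
    using x' by (meson Int_iff ends_in_segment(1) subset_closed_segment subset_iff)
  then have uw_sub: "closed_segment u w \<subseteq> closed_segment u x"
    by (simp add: subset_closed_segment)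
  have disj: "z \<notin> K" if "z \<in> closed_segment u w" for z
  proof
    assume "z \<in> K"
    then have "D \<le> dist u z" using x'_min uw_sub that by (auto simp: D_def)
    moreover have "dist u z \<le> dist u w"
      using that by (metis dist_commute dist_in_closed_segment(1))
    ultimately show False using uw by simp
  qed
  obtain p x0 where p: "p \<in> closed_segment u w" and x0: "x0 \<in> K"
    and px0: "dist p x0 = setdist (closed_segment u w) K"
    using setdist_compact_closed[of "closed_segment u w" K] \<open>closed K\<close> \<open>x \<in> K\<close> by auto
  have min: "dist p x0 \<le> dist p' x1" if "p' \<in> closed_segment u w" "x1 \<in> K" for p' x1
    using px0 setdist_le_dist that by metis
  have "p \<noteq> x0" using disj p x0 by blast
  \<comment> \<open>Since \<open>x0\<close> is nearest to \<open>p\<close> in \<open>K\<close>, it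
    is nearest in each segment \<open>[z, x0]\<close> inside \<open>K\<close>, so the angle at
    \<open>x0\<close> is not acute.\<close>
  have "{z. sees K z x0} \<subseteq> {z. (p - x0) \<bullet> z \<le> (p - x0) \<bullet> x0}"
  proof safe
    fix z assume "sees K z x0"
    then have "closed_segment z x0 \<subseteq> K" by (simp add: sees_def)
    then have "(p - x0) \<bullet> (z - x0) \<le> 0"
      by (intro any_closest_point_dot[of "closed_segment z x0"]) (auto intro: min p)
    then show "(p - x0) \<bullet> z \<le> (p - x0) \<bullet> x0" by (simp add: inner_diff_right)
  qed
  then have "convex hull {z. sees K z x0} \<subseteq> {z. (p - x0) \<bullet> z \<le> (p - x0) \<bullet> x0}"
    by (rule hull_minimal) (rule convex_halfspace_le)
  then have y_le: "(p - x0) \<bullet> (y - x0) \<le> 0"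
    using hull[OF x0] by (auto simp: inner_diff_right)
  have "dist p x0 < e"
    using min[of w x'] x' wx' by simp
  then have "p \<noteq> u" using e(2)[OF x0] by auto
  \<comment> \<open>Conversely \<open>p\<close> is nearest to \<open>x0\<close> on
    \<open>[u, w]\<close>. As \<open>p \<noteq> u\<close>, the vector \<open>u - p\<close> is a
    positive multiple of \<open>y - x\<close>, so the inequality extends from \<open>u\<close> to
    \<open>y\<close>.\<close>
  have "(x0 - p) \<bullet> (u - p) \<le> 0"
    by (rule any_closest_point_dot[of "closed_segment u w"])
      (use p x0 min in \<open>auto simp: dist_commute\<close>)
  moreover obtain r where r: "0 \<le> r" "p = (1 - r) *\<^sub>R u + r *\<^sub>R x"
    using p uw_sub by (auto simp: closed_segment_def)
  moreover have "u - p = (r * (1 - s)) *\<^sub>R (y - x)"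
    unfolding r(2) s(3) by (simp add: algebra_simps)
  moreover have "r > 0" using r \<open>p \<noteq> u\<close> by (cases "r = 0") auto
  moreover have "s < 1" using s \<open>u \<noteq> x\<close> by (cases "s = 1") auto
  ultimately have "(x0 - p) \<bullet> (y - x) \<le> 0"
    by (simp add: mult_le_0_iff)
  moreover have "y - p = (s + r * (1 - s)) *\<^sub>R (y - x)"
    unfolding r(2) s(3) by (simp add: algebra_simps)
  ultimately have "(x0 - p) \<bullet> (y - p) \<le> 0"
    using r s by (simp add: mult_le_0_iff)
  \<comment> \<open>The two obtuse angles, at \<open>x0\<close> and at \<open>p\<close> in the
    triangle \<open>x0\<close>, \<open>p\<close>, \<open>y\<close>, are incompatible.\<close>
  moreover have "(p - x0) \<bullet> (y - x0) = (p - x0) \<bullet> (p - x0) - (x0 - p) \<bullet> (y - p)"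
    by (simp add: inner_diff_left inner_diff_right inner_commute)
  ultimately have "(p - x0) \<bullet> (p - x0) \<le> 0"
    using y_le by linarith
  then show False using \<open>p \<noteq> x0\<close>
    by (metis inner_gt_zero_iff eq_iff_diff_eq_0 linorder_not_less)
qed

text \<open>Pads a smaller set by repeating one element, to fit a hypothesis about families of
  exactly \<open>n\<close> points.\<close>

lemma finite_enum_in:
  assumes "finite J" "J \<noteq> {}" "card J \<le> n"
  obtains f :: "nat \<Rightarrow> 'a" where "f ` {..<n} = J"
proof -
  obtain h where h: "bij_betw h {0..<card J} J"
    using ex_bij_betw_nat_finite[OF \<open>finite J\<close>] by blast
  have pos: "card J > 0" using assms by (simp add: card_gt_0_iff)
  let ?f = "\<lambda>i. if i < card J then h i else h 0"
  have "?f ` {..<n} = h ` {0..<card J}"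
    using pos assms(3) by (force simp: image_iff)
  then show ?thesis using that h by (metis bij_betw_imp_surj_on)
qed

theorem theorem3p10:
  fixes v :: "real ^ 'd" and K :: "(real ^ 'd) set"
  assumes "v \<noteq> 0"
    and "compact K"
    and "\<And>x :: nat \<Rightarrow> real ^ 'd. (\<forall>i < 2 * CARD('d). x i \<in> K) \<Longrightarrow>
           \<exists>a b. v_width v (closed_segment a b) \<ge> 1 \<and>
                 (\<forall>p \<in> closed_segment a b. \<forall>i < 2 * CARD('d). sees K p (x i))"
  shows "\<exists>a b. v_width v (closed_segment a b) \<ge> 1 \<and>
               (\<forall>p \<in> closed_segment a b. \<forall>y \<in> K. sees K p y)"
proof -
  define V where "V x = convex hull {p. sees K p x}" for x
  \<comment> \<open>Prescribing width 1 is a linear equation on pairs of end points, with normal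
    \<open>(v, - v)\<close>; the lower bound 1 alone would not give a hyperplane.\<close>
  define H :: "((real ^ 'd) \<times> (real ^ 'd)) set" where "H = {z. (v, - v) \<bullet> z = 1}"
  have H: "(a, b) \<in> H \<longleftrightarrow> (a - b) \<bullet> v = 1" for a b
    by (simp add: H_def inner_diff_right inner_commute[of "a - b"])
  have "(\<Inter>x\<in>K. (V x \<times> V x) \<inter> H) \<noteq> {}"
  proof (rule Helly_aff_dim_compact[where k = "2 * CARD('d)" and H = H])
    show "aff_dim H < int (2 * CARD('d))"
      unfolding H_def using \<open>v \<noteq> 0\<close> zero_less_card_finite[where 'a = 'd]
      by (subst aff_dim_hyperplane) (auto simp: zero_prod_def of_nat_diff simp del: zero_less_card_finite)
    show "convex ((V x \<times> V x) \<inter> H)" for x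
      unfolding V_def H_def by (intro convex_Int convex_Times convex_convex_hull convex_hyperplane)
    show "compact ((V x \<times> V x) \<inter> H)" for x
      unfolding V_def H_def
      by (intro compact_Int_closed compact_Times compact_convex_hull compact_seeing_set
          closed_hyperplane \<open>compact K\<close>)
    show "(\<Inter>x\<in>J. (V x \<times> V x) \<inter> H) \<noteq> {}"
      if J: "J \<subseteq> K" "finite J" "card J \<le> 2 * CARD('d)" for J
    proof (cases "J = {}")
      case False
      obtain f where f: "f ` {..<2 * CARD('d)} = J"
        using finite_enum_in[OF J(2) False J(3)] by blast
      then have "\<forall>i < 2 * CARD('d). f i \<in> K" using J(1) by blast
      from assms(3)[OF this] obtain a b where ab: "v_width v (closed_segment a b) \<ge> 1"
        and sees: "\<And>p i. p \<in> closed_segment a b \<Longrightarrow> i < 2 * CARD('d) \<Longrightarrow> sees K p (f i)"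
        by blast
      have "closed_segment a b \<subseteq> V x" if "x \<in> J" for x
        using f sees that unfolding V_def by (force intro: hull_inc)
      moreover obtain c d where "c \<in> closed_segment a b" "d \<in> closed_segment a b" "(c - d) \<bullet> v = 1"
        using segment_unit_width[OF ab] by blast
      ultimately have "(c, d) \<in> (\<Inter>x\<in>J. (V x \<times> V x) \<inter> H)"
        using H by blast
      then show ?thesis by blast
    qed simp
  qed auto
  then obtain a b where ab: "(a, b) \<in> (\<Inter>x\<in>K. (V x \<times> V x) \<inter> H)"
    by auto
  show ?thesis
  \<comment> \<open>For empty \<open>K\<close> the intersection is the whole space and says nothing
    about \<open>(a, b)\<close>, so a segment is given explicitly.\<close>
  proof (cases "K = {}")
    case True
    have "1 \<le> v_width v (closed_segment (v /\<^sub>R (v \<bullet> v)) 0)"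
      using \<open>v \<noteq> 0\<close> by (simp add: v_width_closed_segment)
    then show ?thesis using True by blast
  next
    case False
    then have "(a - b) \<bullet> v = 1" using ab H by blast
    then have "1 \<le> v_width v (closed_segment a b)"
      by (simp add: v_width_closed_segment)
    moreover have "sees K p y" if p: "p \<in> closed_segment a b" and "y \<in> K" for p y
    proof (rule seeing_all_if_in_hulls[OF \<open>compact K\<close> _ \<open>y \<in> K\<close>])
      fix x assume "x \<in> K"
      \<comment> \<open>Both ends lie in the convex set \<open>V x\<close>, hence so does every
        \<open>p\<close> between them.\<close>
      then have "a \<in> V x" "b \<in> V x" using ab by blast+
      then show "p \<in> convex hull {p. sees K p x}"
        using p closed_segment_subset[of a "V x" b] unfolding V_def by auto
    qed
    ultimately show ?thesis by blast
  qed
qed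

end
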